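(* Every hypergraph $\mathcal H$ satisfies $\alpha(\mathcal H)\ge \frac12+\frac{\alpha^*(\mathcal H)}{4\,\mathrm{aw}(\mathcal H)}$.
   Context: A hypergraph is a pair $(V,E)$ with $V$ finite and $E\subseteq 2^V\setminus\{\emptyset\}$. An independent set is a vertex set no two distinct elements of which lie in a common hyperedge; $\alpha(\mathcal H)$ is the maximum size of an independent set. A fractional independent set is $\mu:V(\mathcal H)\to[0,1]$ with $\sum_{v\in e}\mu(v)\le1$ for every hyperedge $e$; $\alpha^*(\mathcal H)$ is the maximum of $\sum_v\mu(v)$ over fractional independent sets. A tree decomposition is a tree $\mathcal T$ with bags $B_t\subseteq V(\mathcal H)$ such that every vertex lies in some bag, every hyperedge is contained in some bag, and for every vertex $v$ the nodes whose bags contain $v$ induce a connected subtree. For $\mu$ a fractional independent set, the $\mu$-width of a tree decomposition is $\max_t\sum_{v\in B_t}\mu(v)$, and the $\mu$-width of $\mathcal H$ is the minimum over tree decompositions. The adaptive width $\mathrm{aw}(\mathcal H)$ is the supremum of the $\mu$-width of $\mathcal H$ over all fractional independent sets $\mu$. *)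

theory Defs
  imports Complex_Main "Graph_Theory.Digraph_Component"
begin

definition hypergraph :: "'a set \<Rightarrow> 'a set set \<Rightarrow> bool" where
  "hypergraph V E \<longleftrightarrow> finite V \<and> E \<subseteq> Pow V - {{}}"

definition independent_set :: "'a set \<Rightarrow> 'a set set \<Rightarrow> 'a set \<Rightarrow> bool" where
  "independent_set V E S \<longleftrightarrow>
     S \<subseteq> V \<and> (\<forall>u\<in>S. \<forall>v\<in>S. u \<noteq> v \<longrightarrow> \<not> (\<exists>e\<in>E. u \<in> e \<and> v \<in> e))"

definition independence_number :: "'a set \<Rightarrow> 'a set set \<Rightarrow> nat" where
  "independence_number V E = Max {card S | S. independent_set V E S}"

text \<open>Weight functions are total on the type; only their values on \<open>V\<close> matter below.\<close>

definition fractional_independent_set :: "'a set \<Rightarrow> 'a set set \<Rightarrow> ('a \<Rightarrow> real) \<Rightarrow> bool" where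
  "fractional_independent_set V E \<mu> \<longleftrightarrow>
     (\<forall>v\<in>V. 0 \<le> \<mu> v \<and> \<mu> v \<le> 1) \<and> (\<forall>e\<in>E. (\<Sum>v\<in>e. \<mu> v) \<le> 1)"

text \<open>The supremum is a maximum: up to values outside \<open>V\<close>, the fractional independent
  sets form a nonempty compact polytope.\<close>

definition fractional_independence_number :: "'a set \<Rightarrow> 'a set set \<Rightarrow> real" where
  "fractional_independence_number V E =
     Sup {(\<Sum>v\<in>V. \<mu> v) | \<mu>. fractional_independent_set V E \<mu>}"

text \<open>An undirected tree, as a symmetric loop-free digraph: each undirected edge is a pair of
  antiparallel arcs. These two arcs form a directed cycle of length 2, so undirected cycles are
  the directed cycles of length at least 3; the predicate \<^const>\<open>tree\<close> would
  exclude every edge. \<^const>\<open>connected\<close> entails that there is at least one node.\<close>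

definition undirected_tree :: "'t pair_pre_digraph \<Rightarrow> bool" where
  "undirected_tree T \<longleftrightarrow>
     pair_graph T \<and> connected (with_proj T) \<and>
     \<not> (\<exists>p. pre_digraph.cycle (with_proj T) p \<and> 3 \<le> length p)"

definition tree_decomposition ::
    "'a set \<Rightarrow> 'a set set \<Rightarrow> 't pair_pre_digraph \<Rightarrow> ('t \<Rightarrow> 'a set) \<Rightarrow> bool" where
  "tree_decomposition V E T B \<longleftrightarrow>
     undirected_tree T \<and>
     (\<forall>t\<in>pverts T. B t \<subseteq> V) \<and>
     (\<forall>v\<in>V. \<exists>t\<in>pverts T. v \<in> B t) \<and>
     (\<forall>e\<in>E. \<exists>t\<in>pverts T. e \<subseteq> B t) \<and>
     (\<forall>v\<in>V. connected (with_proj T \<restriction> {t \<in> pverts T. v \<in> B t}))"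

definition decomposition_width ::
    "('a \<Rightarrow> real) \<Rightarrow> 't pair_pre_digraph \<Rightarrow> ('t \<Rightarrow> 'a set) \<Rightarrow> real" where
  "decomposition_width \<mu> T B = Max ((\<lambda>t. \<Sum>v\<in>B t. \<mu> v) ` pverts T)"

text \<open>Decomposition trees are finite, so nodes in \<^typ>\<open>nat\<close> cover all of them up to
  isomorphism. The infimum is a minimum: widths are weights of subsets of \<open>V\<close>, so they take
  finitely many values, and the one-node tree with bag \<open>V\<close> is a decomposition.\<close>

definition mu_width :: "'a set \<Rightarrow> 'a set set \<Rightarrow> ('a \<Rightarrow> real) \<Rightarrow> real" where
  "mu_width V E \<mu> =
     Inf {decomposition_width \<mu> T B | (T :: nat pair_pre_digraph) B. tree_decomposition V E T B}"

definition adaptive_width :: "'a set \<Rightarrow> 'a set set \<Rightarrow> real" where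
  "adaptive_width V E = Sup {mu_width V E \<mu> | \<mu>. fractional_independent_set V E \<mu>}"

end

theory Submission
  imports Defs
begin

text \<open>Fix a fractional independent set \<open>\<mu>\<close> and a tree decomposition of \<open>\<mu>\<close>-width \<open>w\<close>, and root
  the tree. Every vertex occupies a subtree, which has a top node. Repeatedly pick a vertex whose
  top node \<open>t\<close> is deepest and discard all vertices whose subtrees contain \<open>t\<close>: every remaining
  subtree is disjoint from that of the picked vertex, and the discarded vertices lie in the bag
  of \<open>t\<close>, so they weigh at most \<open>w\<close>. The picked vertices have pairwise disjoint subtrees, hence
  are independent, and \<open>\<mu>(V) \<le> \<alpha> w\<close>. Optimising over the decomposition and over \<open>\<mu>\<close>
  gives \<open>\<alpha>\<^sup>* \<le> \<alpha> aw\<close>, which implies the claim because \<open>\<alpha> \<ge> 1\<close>.\<close>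

section \<open>Rooting a tree\<close>

text \<open>A path from \<open>b\<close> back to \<open>a\<close> that avoids the edge would close
  up with the arc \<open>(a, b)\<close> to an undirected cycle.\<close>

lemma undirected_tree_bridge:
  assumes tree: "undirected_tree T" and ab: "(a, b) \<in> parcs T"
  shows "(b, a) \<notin> (parcs T - {(a, b), (b, a)})\<^sup>*"
proof
  define Q where "Q = parcs T - {(a, b), (b, a)}"
  define H where "H = \<lparr>pverts = pverts T, parcs = Q\<rparr>"
  have H: "pverts H = pverts T" "parcs H = Q" by (simp_all add: H_def)
  assume "(b, a) \<in> (parcs T - {(a, b), (b, a)})\<^sup>*"
  then have ba: "(b, a) \<in> Q\<^sup>*" by (simp add: Q_def)
  interpret T: pair_graph T using tree by (simp add: undirected_tree_def)
  interpret H: pair_wf_digraph H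
    using T.arc_fst_in_verts T.arc_snd_in_verts
    by unfold_locales (auto simp: H Q_def)
  have "\<exists>q. H.awalk b q a"
    using ba
  proof (induction rule: rtrancl_induct)
    case base
    have "H.awalk b [] b"
      using ab T.in_arcsD2 by (simp add: H.awalk_def H)
    then show ?case by blast
  next
    case (step y z)
    then obtain q where "H.awalk b q y" by blast
    moreover have "H.awalk y [(y, z)] z"
      using step.hyps(2) T.in_arcsD1 T.in_arcsD2
      by (auto simp: H.awalk_def H Q_def)
    ultimately show ?case using H.awalk_appendI by blast
  qed
  then obtain q where q: "H.apath b q a" using H.apath_awalk_to_apath by blast
  then have walk: "pcas b q a" "set q \<subseteq> Q" and dist: "distinct (pawalk_verts b q)"
    by (auto simp: H.apath_def H.awalk_def H)
  have "a \<noteq> b" using T.pair_no_loops ab by fastforce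
  \<comment> \<open>An empty path would give \<open>a = b\<close>, and a single arc would be the
    deleted \<open>(b, a)\<close>. So the closed walk is longer than the harmless 2-cycle of
    antiparallel arcs.\<close>
  then have "2 \<le> length q"
    using walk by (cases q rule: remdups_adj.cases) (auto simp: Q_def)
  moreover have "T.cycle ((a, b) # q)"
    using walk dist ab T.in_arcsD1
    by (auto simp: T.cycle_def T.awalk_def Q_def intro!: exI[of _ a])
  ultimately show False
    using tree unfolding undirected_tree_def
    by (metis One_nat_def Suc_le_mono eval_nat_numeral(3) length_Cons numeral_2_eq_2)
qed

lemma connected_symmetric_rtrancl:
  assumes "connected G" "sym (arcs_ends G)" "u \<in> verts G" "v \<in> verts G"
  shows "(u, v) \<in> rtrancl_on (verts G) (arcs_ends G)"
proof -
  have "(arcs_ends G)\<^sup>s = arcs_ends G"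
    using assms(2) by (auto simp: symcl_def dest: symD)
  then show ?thesis using assms by (auto simp: connected_conv)
qed

lemma undirected_tree_sym:
  assumes "undirected_tree T"
  shows "sym (parcs T)"
proof -
  interpret pair_graph T using assms by (simp add: undirected_tree_def)
  show ?thesis using pair_sym_arcs by (simp add: symmetric_def)
qed

text \<open>Take \<open>d\<close> as the distance from a root \<open>r\<close> and let
  \<open>p\<close> choose a neighbour closer to \<open>r\<close>. An arc that joins no node to its
  parent could be bypassed through \<open>r\<close>, against
  \<open>undirected_tree_bridge\<close>.\<close>

lemma undirected_tree_parent:
  assumes tree: "undirected_tree T"
  obtains p :: "'t \<Rightarrow> 't" and d :: "'t \<Rightarrow> nat"
  where "\<And>a b. (a, b) \<in> parcs T \<Longrightarrow> b = p a \<and> d b < d a \<or> a = p b \<and> d a < d b"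
proof -
  define R where "R = parcs T"
  interpret T: pair_graph T using tree by (simp add: undirected_tree_def)
  have sym: "sym R" using undirected_tree_sym[OF tree] by (simp add: R_def)
  have conn: "connected (with_proj T)" using tree by (simp add: undirected_tree_def)
  then obtain r where r: "r \<in> pverts T" by (auto simp: connected_conv)
  have reach: "(r, x) \<in> R\<^sup>*" if "x \<in> pverts T" for x
    using connected_symmetric_rtrancl[OF conn, of r x] sym r that
    by (auto simp: R_def intro: rtrancl_on_rtranclI)
  define d where "d x = (LEAST n. (r, x) \<in> R ^^ n)" for x
  have "\<exists>y. (y, x) \<in> R \<and> d y < d x" if x: "x \<in> pverts T" "x \<noteq> r" for x
  proof -
    have "\<exists>n. (r, x) \<in> R ^^ n" using reach[OF x(1)] by (simp add: rtrancl_power)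
    then have dx: "(r, x) \<in> R ^^ d x" unfolding d_def by (rule LeastI_ex)
    then obtain n where n: "d x = Suc n" using x(2) by (cases "d x") auto
    with dx obtain y where y: "(r, y) \<in> R ^^ n" "(y, x) \<in> R" by auto
    then have "d y \<le> n" unfolding d_def by (intro Least_le)
    with y n show ?thesis by auto
  qed
  then obtain p where p: "\<And>x. x \<in> pverts T \<Longrightarrow> x \<noteq> r \<Longrightarrow> (p x, x) \<in> R \<and> d (p x) < d x"
    by metis
  show thesis
  proof (rule that)
    fix a b
    assume ab: "(a, b) \<in> parcs T"
    define Q where "Q = R - {(a, b), (b, a)}"
    show "b = p a \<and> d b < d a \<or> a = p b \<and> d a < d b"
    proof (rule ccontr)
      \<comment> \<open>Otherwise both ends of the arc reach the root through parents without using the arc.\<close>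
      assume neg: "\<not> ?thesis"
      have "(x, r) \<in> Q\<^sup>*" if "x \<in> pverts T" for x
        using that
      proof (induction "d x" arbitrary: x rule: less_induct)
        case less
        show ?case
        proof (cases "x = r")
          case False
          then have px: "(p x, x) \<in> R" "d (p x) < d x" using p less.prems by auto
          then have "p x \<in> pverts T" using T.in_arcsD1 by (simp add: R_def)
          then have "(p x, r) \<in> Q\<^sup>*" using less.hyps px by blast
          moreover have "(x, p x) \<in> Q"
            using px sym neg by (auto simp: Q_def dest: symD)
          ultimately show ?thesis by (meson converse_rtrancl_into_rtrancl)
        qed simp
      qed
      then have "(b, r) \<in> Q\<^sup>*" "(a, r) \<in> Q\<^sup>*"
        using ab T.in_arcsD1 T.in_arcsD2 by blast+
      moreover have "sym (Q\<^sup>*)"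
        using sym by (intro sym_rtrancl) (auto simp: Q_def sym_def)
      ultimately have "(b, a) \<in> Q\<^sup>*" by (meson rtrancl_trans symD)
      then show False using undirected_tree_bridge[OF tree ab] by (simp add: Q_def R_def)
    qed
  qed
qed

section \<open>Subtrees of a rooted tree\<close>

text \<open>Closure under parents below \<open>t\<close> stands in for connectedness. The arguments
  about tops need only this closure and induction on \<open>d\<close>, not the graph.\<close>

definition subtree_top :: "('t \<Rightarrow> 't) \<Rightarrow> ('t \<Rightarrow> nat) \<Rightarrow> 't set \<Rightarrow> 't \<Rightarrow> bool" where
  "subtree_top p d S t \<longleftrightarrow> t \<in> S \<and> (\<forall>x\<in>S. x \<noteq> t \<longrightarrow> p x \<in> S \<and> d (p x) < d x)"

text \<open>The top is a node of \<open>S\<close> of least depth. Any walk inside \<open>S\<close>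
  from \<open>t\<close> to \<open>x\<close> can be traded for a pure climb from \<open>x\<close> to
  \<open>t\<close>.\<close>

lemma connected_imp_subtree_top:
  assumes parent: "\<And>a b. (a, b) \<in> parcs T \<Longrightarrow> b = p a \<and> d b < d a \<or> a = p b \<and> d a < d b"
    and sym: "sym (parcs T)"
    and conn: "connected (with_proj T \<restriction> S)"
  shows "\<exists>t. subtree_top p d S t"
proof -
  let ?G = "with_proj T \<restriction> S"
  have ends: "arcs_ends ?G = parcs T \<inter> S \<times> S"
    by (auto simp: arcs_ends_conv induce_subgraph_def image_iff)
  have "S \<noteq> {}" using conn by (auto simp: connected_conv)
  then obtain t where t: "t \<in> S" "\<And>x. x \<in> S \<Longrightarrow> d t \<le> d x"
    using arg_min_natI[of "\<lambda>x. x \<in> S" _ d] arg_min_nat_le[of "\<lambda>x. x \<in> S" _ d] by blast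
  \<comment> \<open>Each node has at most one \<open>D\<close>-successor, so a \<open>D\<close>-path
    from \<open>x \<noteq> t\<close> to \<open>t\<close> must start with the step to
    \<open>p x\<close>.\<close>
  define D where "D = {(x, p x) | x. x \<in> S \<and> p x \<in> S \<and> d (p x) < d x}"
  have down: "(x, t) \<in> D\<^sup>*" if "x \<in> S" for x
  proof -
    have "(t, x) \<in> rtrancl_on S (parcs T \<inter> S \<times> S)"
      using connected_symmetric_rtrancl[OF conn, of t x] t(1) that sym
      by (auto simp: ends sym_def)
    then show ?thesis
    proof (induction rule: rtrancl_on_induct)
      case (step y z)
      then consider "z = p y" "d z < d y" | "y = p z" "d y < d z" using parent by blast
      then show ?case
      proof cases
        \<comment> \<open>The walk moves up. Minimality of \<open>d t\<close> gives
          \<open>y \<noteq> t\<close>, so the climb from \<open>y\<close> passes through its parent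
          \<open>z\<close>, and its remainder is the climb from \<open>z\<close>.\<close>
        case 1
        with t(2)[OF \<open>z \<in> S\<close>] have "y \<noteq> t" by auto
        with \<open>(y, t) \<in> D\<^sup>*\<close> obtain y' where "(y, y') \<in> D" "(y', t) \<in> D\<^sup>*"
          by (metis converse_rtranclE)
        with 1 show ?thesis by (auto simp: D_def)
      next
        case 2
        with step have "(z, y) \<in> D" by (auto simp: D_def)
        with step show ?thesis by (meson converse_rtrancl_into_rtrancl)
      qed
    qed simp
  qed
  have "p x \<in> S \<and> d (p x) < d x" if "x \<in> S" "x \<noteq> t" for x
    using down[OF that(1)] that(2) by (cases rule: converse_rtranclE) (auto simp: D_def)
  with t show ?thesis by (auto simp: subtree_top_def)
qed

lemma subtree_top_le:
  assumes "subtree_top p d S t" "x \<in> S"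
  shows "d t \<le> d x"
  using assms(2)
proof (induction "d x" arbitrary: x rule: less_induct)
  case less
  show ?case
  proof (cases "x = t")
    case False
    then have "p x \<in> S" "d (p x) < d x" using assms(1) less.prems by (auto simp: subtree_top_def)
    then show ?thesis using less.hyps[of "p x"] by simp
  qed simp
qed

text \<open>Climb from a common node \<open>x\<close> to \<open>t'\<close>. Before \<open>t'\<close>
  is reached, \<open>x\<close> is strictly deeper than \<open>t'\<close>, hence differs from
  \<open>t\<close>, so the climb stays in \<open>S\<close> as well.\<close>

lemma subtree_top_meet:
  assumes S: "subtree_top p d S t" and S': "subtree_top p d S' t'"
    and "x \<in> S" "x \<in> S'" and le: "d t \<le> d t'"
  shows "t' \<in> S"
  using assms(3,4)
proof (induction "d x" arbitrary: x rule: less_induct)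
  case less
  show ?case
  proof (cases "x = t'")
    case False
    then have px: "p x \<in> S'" "d (p x) < d x" using S' less.prems by (auto simp: subtree_top_def)
    then have "x \<noteq> t" using subtree_top_le[OF S' px(1)] le by auto
    then have "p x \<in> S" using S less.prems by (auto simp: subtree_top_def)
    then show ?thesis using less.hyps px by blast
  qed (use less in simp)
qed

lemma subtree_packing:
  fixes \<mu> :: "'a \<Rightarrow> real" and N :: "'a \<Rightarrow> 't set"
  assumes "finite U"
    and "\<And>v. v \<in> U \<Longrightarrow> subtree_top p d (N v) (t v)"
    and "\<And>v. v \<in> U \<Longrightarrow> 0 \<le> \<mu> v"
    and "\<And>v. v \<in> U \<Longrightarrow> sum \<mu> {u \<in> U. t v \<in> N u} \<le> w"
  shows "\<exists>S\<subseteq>U. pairwise (\<lambda>u v. N u \<inter> N v = {}) S \<and> sum \<mu> U \<le> real (card S) * w"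
  using assms
proof (induction U rule: finite_psubset_induct)
  case (psubset U)
  show ?case
  proof (cases "U = {}")
    case False
    then obtain v where v: "v \<in> U" "\<And>u. u \<in> U \<Longrightarrow> d (t u) \<le> d (t v)"
      using psubset.hyps Max_in[of "(\<lambda>u. d (t u)) ` U"] Max_ge[of "(\<lambda>u. d (t u)) ` U"]
      by fastforce
    define U' where "U' = {u \<in> U. t v \<notin> N u}"
    have sub: "U' \<subseteq> U" and "v \<notin> U'"
      using v(1) psubset.prems(1) by (auto simp: U'_def subtree_top_def)
    \<comment> \<open>The weight bound is inherited by \<open>U'\<close>: by nonnegativity,
      discarding vertices never increases a weight.\<close>
    have "sum \<mu> {u \<in> U'. t x \<in> N u} \<le> w" if "x \<in> U'" for x
    proof -
      have "sum \<mu> {u \<in> U'. t x \<in> N u} \<le> sum \<mu> {u \<in> U. t x \<in> N u}"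
        using psubset.hyps psubset.prems(2) sub by (intro sum_mono2) auto
      also have "\<dots> \<le> w" using psubset.prems(3) that sub by blast
      finally show ?thesis .
    qed
    then obtain S where S: "S \<subseteq> U'" "pairwise (\<lambda>u v. N u \<inter> N v = {}) S"
        "sum \<mu> U' \<le> real (card S) * w"
      using psubset.IH[of U'] sub \<open>v \<notin> U'\<close> v(1) psubset.prems by blast
    \<comment> \<open>Since \<open>t v\<close> is deepest, a subtree meeting \<open>N v\<close>
      would contain \<open>t v\<close>, and \<open>u\<close> would have been discarded.\<close>
    have "N u \<inter> N v = {}" if "u \<in> S" for u
      using subtree_top_meet[of p d "N u" "t u" "N v" "t v"] that S(1) v psubset.prems(1)
      by (auto simp: U'_def)
    then have "pairwise (\<lambda>u v. N u \<inter> N v = {}) (insert v S)"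
      using S(2) by (auto simp: pairwise_insert)
    moreover have "sum \<mu> U \<le> real (card (insert v S)) * w"
    proof -
      have "U = {u \<in> U. t v \<in> N u} \<union> U'" by (auto simp: U'_def)
      then have "sum \<mu> U = sum \<mu> {u \<in> U. t v \<in> N u} + sum \<mu> U'"
        using psubset.hyps by (subst sum.union_disjoint[symmetric]) (auto simp: U'_def)
      also have "\<dots> \<le> w + real (card S) * w"
        using S(3) psubset.prems(3)[OF v(1)] by simp
      also have "\<dots> = real (card (insert v S)) * w"
        using S(1) \<open>v \<notin> U'\<close> finite_subset[OF _ psubset.hyps(1)] sub
        by (subst card_insert_disjoint) (auto simp: algebra_simps)
      finally show ?thesis .
    qed
    ultimately show ?thesis using S(1) sub v(1) by (intro exI[of _ "insert v S"]) auto
  qed auto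
qed

section \<open>Independence number and adaptive width\<close>

lemma
  assumes "finite V"
  shows card_le_independence_number:
      "independent_set V E S \<Longrightarrow> card S \<le> independence_number V E"
    and independence_number_ge_1: "V \<noteq> {} \<Longrightarrow> 1 \<le> independence_number V E"
proof -
  have "{card S | S. independent_set V E S} \<subseteq> card ` Pow V"
    by (auto simp: independent_set_def)
  then have "finite {card S | S. independent_set V E S}"
    using assms by (simp add: finite_subset)
  then show le: "card S \<le> independence_number V E" if "independent_set V E S" for S
    using that unfolding independence_number_def by (intro Max_ge) auto
  assume "V \<noteq> {}"
  then obtain v where "v \<in> V" by blast
  then have "independent_set V E {v}" by (simp add: independent_set_def)
  from le[OF this] show "1 \<le> independence_number V E" by simp
qed

lemma weight_le_independence_number_times_width:
  assumes "finite V" and frac: "fractional_independent_set V E \<mu>"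
    and dec: "tree_decomposition V E T B"
  shows "sum \<mu> V \<le> real (independence_number V E) * decomposition_width \<mu> T B"
proof -
  let ?w = "decomposition_width \<mu> T B"
  have tree: "undirected_tree T" using dec by (simp add: tree_decomposition_def)
  interpret pair_graph T using tree by (simp add: undirected_tree_def)
  have w: "sum \<mu> (B t) \<le> ?w" if "t \<in> pverts T" for t
    unfolding decomposition_width_def using that pair_finite_verts by (intro Max_ge) auto
  have nonneg: "0 \<le> \<mu> v" if "v \<in> V" for v
    using frac that by (simp add: fractional_independent_set_def)
  define N where "N v = {t \<in> pverts T. v \<in> B t}" for v
  obtain p and d :: "_ \<Rightarrow> nat" where
    "\<And>a b. (a, b) \<in> parcs T \<Longrightarrow> b = p a \<and> d b < d a \<or> a = p b \<and> d a < d b"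
    using undirected_tree_parent[OF tree] by blast
  then have "\<exists>t. subtree_top p d (N v) t" if "v \<in> V" for v
    using connected_imp_subtree_top[of T p d "N v"] undirected_tree_sym[OF tree] dec that
    by (auto simp: tree_decomposition_def N_def)
  then obtain t where t: "\<And>v. v \<in> V \<Longrightarrow> subtree_top p d (N v) (t v)" by metis
  have "sum \<mu> {u \<in> V. t v \<in> N u} \<le> ?w" if "v \<in> V" for v
  proof -
    have tv: "t v \<in> pverts T" using t[OF that] by (simp add: subtree_top_def N_def)
    \<comment> \<open>The vertices discarded together with \<open>v\<close> form exactly one bag, so
      the width bounds their weight.\<close>
    then have "{u \<in> V. t v \<in> N u} = B (t v)"
      using dec by (auto simp: N_def tree_decomposition_def)
    then show ?thesis using w[OF tv] by simp
  qed
  then obtain S where S: "S \<subseteq> V" "pairwise (\<lambda>u v. N u \<inter> N v = {}) S"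
      "sum \<mu> V \<le> real (card S) * ?w"
    using subtree_packing[OF \<open>finite V\<close>, of p d N t \<mu> ?w] t nonneg by blast
  \<comment> \<open>A hyperedge through \<open>u\<close> and \<open>v\<close> lies in one bag, whose
    node would be common to both subtrees.\<close>
  have "independent_set V E S"
    unfolding independent_set_def
  proof (intro conjI ballI impI notI)
    fix u v assume uv: "u \<in> S" "v \<in> S" "u \<noteq> v" and "\<exists>e\<in>E. u \<in> e \<and> v \<in> e"
    then obtain e where e: "e \<in> E" "u \<in> e" "v \<in> e" by blast
    moreover obtain x where "x \<in> pverts T" "e \<subseteq> B x"
      using dec e(1) by (auto simp: tree_decomposition_def)
    ultimately have "x \<in> pverts T" "u \<in> B x" "v \<in> B x" by auto
    then have "x \<in> N u \<inter> N v" by (simp add: N_def)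
    then show False using S(2) uv by (auto simp: pairwise_def)
  qed (use S in auto)
  then have "card S \<le> independence_number V E"
    by (rule card_le_independence_number[OF \<open>finite V\<close>])
  moreover have "0 \<le> ?w"
  proof -
    obtain x where x: "x \<in> pverts T"
      using tree by (auto simp: undirected_tree_def connected_conv)
    have "0 \<le> sum \<mu> (B x)"
      using dec x nonneg by (intro sum_nonneg) (auto simp: tree_decomposition_def)
    with w[OF x] show ?thesis by simp
  qed
  ultimately have "real (card S) * ?w \<le> real (independence_number V E) * ?w"
    by (intro mult_right_mono) auto
  with S(3) show ?thesis by simp
qed

text \<open>Makes the set of widths nonempty, so that its infimum is meaningful, and bounds the
  \<open>\<mu>\<close>-width by the total weight.\<close>

lemma tree_decomposition_single_bag:
  assumes "hypergraph V E"
  shows "tree_decomposition V E \<lparr>pverts = {x}, parcs = {}\<rparr> (\<lambda>_. V)"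
proof -
  let ?T = "\<lparr>pverts = {x}, parcs = {}\<rparr>"
  have [simp]: "connected (with_proj ?T)" by (simp add: connected_conv)
  interpret pair_graph ?T
    by unfold_locales (auto simp: symmetric_def sym_def)
  have "undirected_tree ?T"
    unfolding undirected_tree_def using pair_graph_axioms
    by (auto simp: cycle_def awalk_def)
  moreover have "connected (with_proj ?T \<restriction> {x})" by (simp add: connected_conv)
  ultimately show ?thesis
    using assms by (auto simp: tree_decomposition_def hypergraph_def)
qed

lemma
  assumes hyp: "hypergraph V E" and V: "V \<noteq> {}" and frac: "fractional_independent_set V E \<mu>"
  shows weight_le_independence_number_times_mu_width:
      "sum \<mu> V \<le> real (independence_number V E) * mu_width V E \<mu>"
    and mu_width_le_weight: "mu_width V E \<mu> \<le> sum \<mu> V"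
proof -
  let ?a = "real (independence_number V E)"
  let ?W = "{decomposition_width \<mu> T B | (T :: nat pair_pre_digraph) B. tree_decomposition V E T B}"
  have "finite V" using hyp by (simp add: hypergraph_def)
  then have a: "0 < ?a" using independence_number_ge_1[of V E] V by simp
  have "decomposition_width \<mu> \<lparr>pverts = {0::nat}, parcs = {}\<rparr> (\<lambda>_. V) = sum \<mu> V"
    by (simp add: decomposition_width_def)
  then have mem: "sum \<mu> V \<in> ?W" using tree_decomposition_single_bag[OF hyp, of "0::nat"] by force
  \<comment> \<open>Dividing by \<alpha> > 0 yields a lower bound common to all decompositions,
    which passes to the infimum.\<close>
  have low: "sum \<mu> V / ?a \<le> x" if "x \<in> ?W" for x
    using that weight_le_independence_number_times_width[OF \<open>finite V\<close> frac] a
    by (auto simp: field_simps)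
  have "sum \<mu> V / ?a \<le> mu_width V E \<mu>"
    unfolding mu_width_def using mem low by (intro cInf_greatest) auto
  then show "sum \<mu> V \<le> ?a * mu_width V E \<mu>" using a by (simp add: field_simps)
  show "mu_width V E \<mu> \<le> sum \<mu> V"
    unfolding mu_width_def using mem low by (intro cInf_lower bdd_belowI) auto
qed

lemma fractional_independence_number_le:
  assumes hyp: "hypergraph V E" and V: "V \<noteq> {}"
  shows "fractional_independence_number V E \<le> real (independence_number V E) * adaptive_width V E"
  unfolding fractional_independence_number_def
proof (rule cSup_least)
  have "fractional_independent_set V E (\<lambda>_. 0)" by (simp add: fractional_independent_set_def)
  then show "{\<Sum>v\<in>V. \<mu> v |\<mu>. fractional_independent_set V E \<mu>} \<noteq> {}" by blast
next
  fix x assume "x \<in> {\<Sum>v\<in>V. \<mu> v |\<mu>. fractional_independent_set V E \<mu>}"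
  then obtain \<mu> where \<mu>: "fractional_independent_set V E \<mu>" "x = sum \<mu> V" by blast
  \<comment> \<open>A real \<open>Sup\<close> is an upper bound only for a set bounded above;
    \<open>card V\<close> is a bound uniform in the weight function.\<close>
  have "mu_width V E \<nu> \<le> real (card V)" if "fractional_independent_set V E \<nu>" for \<nu>
  proof -
    have "sum \<nu> V \<le> (\<Sum>v\<in>V. 1)"
      using that by (intro sum_mono) (simp add: fractional_independent_set_def)
    with mu_width_le_weight[OF hyp V that] show ?thesis by simp
  qed
  then have "mu_width V E \<mu> \<le> adaptive_width V E"
    unfolding adaptive_width_def using \<mu>(1)
    by (intro cSup_upper bdd_aboveI[where M = "real (card V)"]) auto
  then have "real (independence_number V E) * mu_width V E \<mu>
      \<le> real (independence_number V E) * adaptive_width V E"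
    by (intro mult_left_mono) auto
  with weight_le_independence_number_times_mu_width[OF hyp V \<mu>(1)] \<mu>(2)
  show "x \<le> real (independence_number V E) * adaptive_width V E" by simp
qed

lemma fractional_independence_number_nonneg:
  assumes "finite V"
  shows "0 \<le> fractional_independence_number V E"
  unfolding fractional_independence_number_def
proof (rule cSup_upper)
  have "fractional_independent_set V E (\<lambda>_. 0)" by (simp add: fractional_independent_set_def)
  then show "0 \<in> {\<Sum>v\<in>V. \<mu> v |\<mu>. fractional_independent_set V E \<mu>}" by force
  have "sum \<mu> V \<le> (\<Sum>v\<in>V. 1)" if "fractional_independent_set V E \<mu>" for \<mu>
    using that by (intro sum_mono) (simp add: fractional_independent_set_def)
  then show "bdd_above {\<Sum>v\<in>V. \<mu> v |\<mu>. fractional_independent_set V E \<mu>}"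
    by (intro bdd_aboveI[where M = "real (card V)"]) auto
qed

theorem theorem3:
  fixes V :: "'a set" and E :: "'a set set"
  assumes "hypergraph V E" and "V \<noteq> {}"
  shows "real (independence_number V E) \<ge>
           1 / 2 + fractional_independence_number V E / (4 * adaptive_width V E)"
proof -
  let ?a = "real (independence_number V E)"
  let ?f = "fractional_independence_number V E" and ?w = "adaptive_width V E"
  have "finite V" using assms(1) by (simp add: hypergraph_def)
  \<comment> \<open>Nonemptiness of \<open>V\<close> enters here: for empty \<open>V\<close> the
    claim would read 1/2 \<le> 0.\<close>
  then have a: "1 \<le> ?a" and "0 \<le> ?f"
    using independence_number_ge_1[of V E] assms(2) fractional_independence_number_nonneg[of V E]
    by auto
  have "?f / ?w \<le> ?a"
  proof (cases "0 < ?w")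
    case True
    then show ?thesis
      using fractional_independence_number_le[OF assms] by (simp add: field_simps)
  next
    case False
    \<comment> \<open>This includes \<open>?w = 0\<close>, where the quotient is 0 by
      convention.\<close>
    then have "?f / ?w \<le> 0" using \<open>0 \<le> ?f\<close> by (simp add: divide_le_0_iff)
    then show ?thesis using a by simp
  qed
  moreover have "?f / (4 * ?w) = ?f / ?w / 4" by simp
  \<comment> \<open>The right-hand side is at most 1/2 + \<alpha>/4, which is at most \<alpha> once
    \<alpha> \<ge> 2/3.\<close>
  ultimately show ?thesis using a by linarith
qed

end
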